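(* Suppose that $W$ satisfies the second structural condition. Then for any $p\in(1,\infty)$ the operator $I_{\frac{p-1}{p}}$ maps $\mathfrak{W}$ to $B_p^{0,1}$ (boundedly). In other words, $\mathfrak{W}\hookrightarrow B_p^{-\frac{p-1}{p},1}$ continuously: there is a constant $C$, independent of $F$, such that $\|F\|_{B_p^{-\frac{p-1}{p},1}}\le C\|F\|_{L_1}$ for all $F\in\mathfrak{W}$.
   Context: Fix integers $m\ge 3$ and $\ell\ge 1$. Consider a probability space with an $m$-uniform filtration $\mathcal{F}=\{\mathcal{F}_n\}_{n\ge0}$: $\mathcal{F}_0$ is trivial, each $\mathcal{F}_n$ is a finite algebra with set of atoms $\mathcal{AF}_n$, and each atom in $\mathcal{F}_n$ is split into $m$ atoms of $\mathcal{F}_{n+1}$ (its children) of equal probability. All martingales are adapted to $\mathcal{F}$; for a martingale $F=\{F_n\}_{n\ge0}$ put $f_{n+1}=F_{n+1}-F_n$ for $n\ge 0$, and $f_0=F_0$. The norm $\|\cdot\|$ on $\mathbb{R}^\ell$ is Euclidean. Let $V=\{v\in\mathbb{R}^m : \sum_{j=1}^m v_j=0\}$. Elements of $V^\ell$ are identified with $m$-tuples $\{b_j\}_{j=1}^m$ of vectors $b_j\in\mathbb{R}^\ell$ with $\sum_j b_j=0$; for $v\in V$, $a\in\mathbb{R}^\ell$, $v\otimes a=\{v_j a\}_{j=1}^m$. For each $n$ and $\omega\in\mathcal{AF}_n$ fix a bijection $J_\omega$ from $\{1,\dots,m\}$ onto the set of children of $\omega$; for $b\in V^\ell$ let $J_\omega[b]$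 be the function on $\omega$ equal to $b_j$ on the child $J_\omega(j)$. Let $W$ be a linear subspace of $V^\ell$. $L_1(\mathbb{R}^\ell)$ is the space of $\mathbb{R}^\ell$-valued martingales with $\|F\|_{L_1}=\sup_n\mathbb{E}\|F_n\|<\infty$, and $$\mathfrak{W}=\{F\in L_1(\mathbb{R}^\ell) : \forall n\ge0,\ \forall\omega\in\mathcal{AF}_n,\ f_{n+1}|_\omega\in J_\omega[W]\},$$ with the norm $\|F\|_{\mathfrak{W}}=\|F\|_{L_1}$. Second structural condition on $W$: $W$ contains no non-zero vector $v\otimes a$ with $a\in\mathbb{R}^\ell$ and $v\in V$ having $m-1$ equal coordinates. Riesz potential: $I_\alpha[F]$ is the martingale with $(I_\alpha[F])_N=\sum_{n=1}^N m^{-\alpha n}f_n$. Besov space: $B_p^{\beta,1}$ is the space of martingales $F$ with $\|F\|_{B_p^{\beta,1}}=\sum_{n=0}^\infty m^{\beta n}\|f_n\|_{L_p}<\infty$, where $\|f_n\|_{L_p}=(\mathbb{E}\|f_n\|^p)^{1/p}$. *)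

theory Defs
  imports "HOL-Probability.Probability"
begin

definition atoms :: "'a measure \<Rightarrow> 'a set set" where
  "atoms G = {A \<in> sets G. A \<noteq> {} \<and> (\<forall>B\<in>sets G. B \<subseteq> A \<longrightarrow> B = {} \<or> B = A)}"

definition children :: "(nat \<Rightarrow> 'a measure) \<Rightarrow> nat \<Rightarrow> 'a set \<Rightarrow> 'a set set" where
  "children \<F> n \<omega> = {\<omega>' \<in> atoms (\<F> (Suc n)). \<omega>' \<subseteq> \<omega>}"

text \<open>The algebras of the filtration are given by measures \<open>\<F> n\<close>, of which only
  \<open>space\<close> and \<open>sets\<close> matter; all probabilities are taken with respect to \<open>M\<close>.\<close>

locale uniform_filtration = prob_space M + filtration "space M" \<F>
  for M :: "'a measure" and \<F> :: "nat \<Rightarrow> 'a measure" and m :: nat +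
  assumes subalg: "\<And>n. subalgebra M (\<F> n)"
    and trivial_0: "sets (\<F> 0) = {{}, space M}"
    and finite_alg: "\<And>n. finite (sets (\<F> n))"
    and card_children: "\<And>n \<omega>. \<omega> \<in> atoms (\<F> n) \<Longrightarrow> card (children \<F> n \<omega>) = m"
    and equal_prob: "\<And>n \<omega> \<omega>' \<omega>''. \<omega> \<in> atoms (\<F> n) \<Longrightarrow> \<omega>' \<in> children \<F> n \<omega> \<Longrightarrow>
      \<omega>'' \<in> children \<F> n \<omega> \<Longrightarrow> measure M \<omega>' = measure M \<omega>''"

text \<open>The last clause states \<open>E(X (Suc n) | \<F> n) = X n\<close> by the defining property of the
  conditional expectation (the library's \<open>real_cond_exp\<close> covers only real-valued functions).\<close>

definition martingale ::
  "'a measure \<Rightarrow> (nat \<Rightarrow> 'a measure) \<Rightarrow> (nat \<Rightarrow> 'a \<Rightarrow> 'v::euclidean_space) \<Rightarrow> bool" where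
  "martingale M \<F> X \<longleftrightarrow>
     (\<forall>n. X n \<in> borel_measurable (\<F> n)) \<and>
     (\<forall>n. integrable M (X n)) \<and>
     (\<forall>n. \<forall>A\<in>sets (\<F> n). (LINT x:A|M. X (Suc n) x) = (LINT x:A|M. X n x))"

fun mdiff :: "(nat \<Rightarrow> 'a \<Rightarrow> 'v::euclidean_space) \<Rightarrow> nat \<Rightarrow> 'a \<Rightarrow> 'v" where
  "mdiff X 0 = X 0"
| "mdiff X (Suc n) = (\<lambda>x. X (Suc n) x - X n x)"

definition L1_norm :: "'a measure \<Rightarrow> (nat \<Rightarrow> 'a \<Rightarrow> 'v::euclidean_space) \<Rightarrow> ennreal" where
  "L1_norm M X = (SUP n. \<integral>\<^sup>+ x. ennreal (norm (X n x)) \<partial>M)"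

definition L1_space ::
  "'a measure \<Rightarrow> (nat \<Rightarrow> 'a measure) \<Rightarrow> (nat \<Rightarrow> 'a \<Rightarrow> 'v::euclidean_space) set" where
  "L1_space M \<F> = {X. martingale M \<F> X \<and> L1_norm M X < \<infinity>}"

text \<open>\<open>V_pow\<close> is \<open>V\<^sup>l\<close> for \<open>V = {v \<in> R\<^sup>m. v\<^sub>1 + \<dots> + v\<^sub>m = 0}\<close>,
  viewed as \<open>m\<close>-tuples of vectors of \<open>R\<^sup>l\<close>, with \<open>m = CARD('m)\<close> and \<open>l = CARD('l)\<close>.\<close>

definition V_space :: "(real ^ 'm::finite) set" where
  "V_space = {v. (\<Sum>j\<in>UNIV. v $ j) = 0}"

definition V_pow :: "((real ^ 'l::finite) ^ 'm::finite) set" where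
  "V_pow = {b. (\<Sum>j\<in>UNIV. b $ j) = 0}"

definition tensor :: "real ^ 'm::finite \<Rightarrow> real ^ 'l::finite \<Rightarrow> (real ^ 'l) ^ 'm" where
  "tensor v a = (\<chi> j. (v $ j) *\<^sub>R a)"

definition second_structural_condition :: "((real ^ 'l::finite) ^ 'm::finite) set \<Rightarrow> bool" where
  "second_structural_condition W \<longleftrightarrow>
     \<not> (\<exists>v\<in>V_space. \<exists>a. (\<exists>S c. card S = CARD('m) - 1 \<and> (\<forall>j\<in>S. v $ j = c)) \<and>
          tensor v a \<noteq> 0 \<and> tensor v a \<in> W)"

text \<open>\<open>child_fun (J n \<omega>) b\<close> is \<open>J\<^sub>\<omega>[b]\<close>, extended by 0 off \<open>\<omega>\<close>.\<close>

definition child_fun :: "('m::finite \<Rightarrow> 'a set) \<Rightarrow> (real ^ 'l::finite) ^ 'm \<Rightarrow> 'a \<Rightarrow> real ^ 'l" where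
  "child_fun J b x = (\<Sum>j\<in>UNIV. indicator (J j) x *\<^sub>R (b $ j))"

definition W_space ::
  "'a measure \<Rightarrow> (nat \<Rightarrow> 'a measure) \<Rightarrow> (nat \<Rightarrow> 'a set \<Rightarrow> 'm::finite \<Rightarrow> 'a set) \<Rightarrow>
   ((real ^ 'l::finite) ^ 'm) set \<Rightarrow> (nat \<Rightarrow> 'a \<Rightarrow> real ^ 'l) set" where
  "W_space M \<F> J W = {X \<in> L1_space M \<F>.
     \<forall>n. \<forall>\<omega>\<in>atoms (\<F> n). \<exists>b\<in>W. \<forall>x\<in>\<omega>. mdiff X (Suc n) x = child_fun (J n \<omega>) b x}"

definition riesz ::
  "nat \<Rightarrow> real \<Rightarrow> (nat \<Rightarrow> 'a \<Rightarrow> 'v::euclidean_space) \<Rightarrow> nat \<Rightarrow> 'a \<Rightarrow> 'v" where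
  "riesz m \<alpha> X N x = (\<Sum>n=1..N. (real m powr (- \<alpha> * real n)) *\<^sub>R mdiff X n x)"

text \<open>The Bochner integral is harmless here: functions measurable with respect to a finite algebra
  are simple, so \<open>norm (f x) powr p\<close> is always integrable.\<close>

definition Lp_norm :: "'a measure \<Rightarrow> real \<Rightarrow> ('a \<Rightarrow> 'v::euclidean_space) \<Rightarrow> real" where
  "Lp_norm M p f = (LINT x|M. norm (f x) powr p) powr (1 / p)"

definition besov_norm ::
  "'a measure \<Rightarrow> nat \<Rightarrow> real \<Rightarrow> real \<Rightarrow> (nat \<Rightarrow> 'a \<Rightarrow> 'v::euclidean_space) \<Rightarrow> ennreal" where
  "besov_norm M m \<beta> p X = (\<Sum>n. ennreal (real m powr (\<beta> * real n) * Lp_norm M p (mdiff X n)))"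

definition besov_space ::
  "'a measure \<Rightarrow> (nat \<Rightarrow> 'a measure) \<Rightarrow> nat \<Rightarrow> real \<Rightarrow> real \<Rightarrow>
   (nat \<Rightarrow> 'a \<Rightarrow> 'v::euclidean_space) set" where
  "besov_space M \<F> m \<beta> p = {X. martingale M \<F> X \<and> besov_norm M m \<beta> p X < \<infinity>}"

end

theory Submission
  imports Defs
begin

text \<open>
  A martingale \<open>X\<close> is the sequence of densities of a vector measure that is refined level by level: the
  atom \<open>\<omega>\<close> of level \<open>n\<close> carries the mass \<open>m\<^sup>-\<^sup>n X\<^sub>n(\<omega>)\<close>. In these terms \<open>E \<bar>X\<^sub>n\<bar>\<close> is the total
  variation \<open>S\<^sub>n\<close> at level \<open>n\<close>, and \<open>m\<close> to the power \<open>- n (p - 1) / p\<close> times the \<open>L\<^sup>p\<close>-norm of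
  \<open>X\<^sub>n\<close> is the \<open>\<ell>\<^sup>p\<close>-norm \<open>u\<^sub>n\<close> of the masses of the atoms. The claim is that the \<open>u\<^sub>n\<close> are summable,
  with sum at most a constant times \<open>sup S\<^sub>n\<close>.

  When a mass is split among the children of its atom, either the total variation grows or
  the mass is distributed in nonnegative proportions. In the second case the \<open>\<ell>\<^sup>p\<close>-norm drops strictly
  unless everything goes to one child, and that is what the second structural condition forbids
  (\<open>strict_decrease_without_mass_gain\<close>). By homogeneity and compactness the alternative becomes one
  inequality on a single atom with a factor \<open>\<theta> < 1\<close> (\<open>atom_inequality\<close>). Summed over all
  atoms (\<open>energy_step\<close>), it gives
  \<open>u\<^sub>n\<^sub>+\<^sub>1 \<le> \<theta>' u\<^sub>n + C' (S\<^sub>n\<^sub>+\<^sub>1 - S\<^sub>n)\<close> with \<open>\<theta>' < 1\<close>. Here the increments of \<open>S\<close> telescope, so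
  the sum of all \<open>u\<^sub>n\<close> is bounded (\<open>sum_bound_of_contraction_with_increments\<close>). The jumps are
  controlled by the values before and after them (\<open>energy_mdiff_le\<close>), and the Riesz potential is
  handled by comparing the two Besov norms term by term (\<open>besov_norm_riesz_le\<close>).
\<close>

section \<open>Elementary inequalities\<close>

lemma sum_powr_le_powr_sum:
  fixes a :: "'i \<Rightarrow> real"
  assumes "finite I" "\<And>i. i \<in> I \<Longrightarrow> 0 \<le> a i" "1 \<le> q"
  shows "(\<Sum>i\<in>I. a i powr q) \<le> (\<Sum>i\<in>I. a i) powr q"
proof -
  define s where "s = (\<Sum>i\<in>I. a i)"
  have eq: "x powr q = x * x powr (q - 1)" if "0 \<le> x" for x :: real
    using that by (cases "x = 0") (auto simp: powr_mult_base)
  have s0: "0 \<le> s" unfolding s_def by (rule sum_nonneg) (rule assms)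
  have "(\<Sum>i\<in>I. a i powr q) \<le> (\<Sum>i\<in>I. a i * s powr (q - 1))"
  proof (rule sum_mono)
    fix i assume i: "i \<in> I"
    have "a i \<le> s" unfolding s_def using i assms by (intro member_le_sum) auto
    thus "a i powr q \<le> a i * s powr (q - 1)"
      using assms i by (subst eq) (auto intro!: mult_left_mono powr_mono2)
  qed
  also have "\<dots> = s powr q" using eq[OF s0] by (simp add: s_def sum_distrib_right)
  finally show ?thesis unfolding s_def .
qed

lemma powr_inverse_subadditive:
  fixes x y :: real
  assumes "0 \<le> x" "0 \<le> y" "1 \<le> p"
  shows "(x + y) powr (1/p) \<le> x powr (1/p) + y powr (1/p)"
proof -
  have "(\<Sum>i\<in>UNIV. (if i then x powr (1/p) else y powr (1/p)) powr p)
      \<le> (\<Sum>i\<in>(UNIV::bool set). if i then x powr (1/p) else y powr (1/p)) powr p"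
    using assms by (intro sum_powr_le_powr_sum) auto
  hence "x + y \<le> (x powr (1/p) + y powr (1/p)) powr p"
    using assms by (simp add: UNIV_bool powr_powr add.commute)
  hence "(x + y) powr (1/p) \<le> ((x powr (1/p) + y powr (1/p)) powr p) powr (1/p)"
    using assms by (intro powr_mono2) auto
  thus ?thesis using assms by (simp add: powr_powr)
qed

lemma powr_add_le_two_powr:
  fixes u v :: real
  assumes "0 \<le> u" "0 \<le> v" "0 \<le> p"
  shows "(u + v) powr p \<le> 2 powr p * (u powr p + v powr p)"
proof -
  have "(u + v) powr p \<le> (2 * max u v) powr p" using assms by (intro powr_mono2) auto
  also have "\<dots> = 2 powr p * max u v powr p" using assms by (simp add: powr_mult)
  also have "\<dots> \<le> 2 powr p * (u powr p + v powr p)"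
    by (intro mult_left_mono) (auto simp: max_def)
  finally show ?thesis .
qed

text \<open>Summing the recursion over \<open>n\<close>, the increments of \<open>S\<close> telescope, and \<open>\<theta>\<close> times the sum of \<open>u\<close>
  is absorbed on the left.\<close>

lemma sum_bound_of_contraction_with_increments:
  fixes u S :: "nat \<Rightarrow> real"
  assumes step: "\<And>n. u (Suc n) \<le> \<theta> * u n + C * (S (Suc n) - S n)" and u0: "u 0 \<le> S 0"
    and u: "\<And>n. 0 \<le> u n" and S: "\<And>n. 0 \<le> S n" "\<And>n. S n \<le> L"
    and \<theta>: "0 \<le> \<theta>" "\<theta> < 1" and C: "0 \<le> C"
  shows "(\<Sum>n<N. u n) \<le> (1 + C) / (1 - \<theta>) * L"
proof -
  have "(1 - \<theta>) * (\<Sum>n<N. u n) + u N \<le> S 0 + C * (S N - S 0)"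
  proof (induction N)
    case 0
    show ?case using u0 by simp
  next
    case (Suc N)
    thus ?case using step[of N] by (simp add: algebra_simps)
  qed
  also have "\<dots> \<le> L + C * L"
    using S C by (intro add_mono mult_left_mono) (auto intro: order_trans[of _ "S N"] simp: S)
  finally have "(1 - \<theta>) * (\<Sum>n<N. u n) \<le> (1 + C) * L" using u[of N] by (simp add: algebra_simps)
  thus ?thesis using \<theta> by (simp add: field_simps)
qed

section \<open>The splitting of a single atom\<close>

text \<open>The set \<open>{h \<le> g}\<close> is compact and \<open>k\<close> is bounded away from \<open>0\<close> on it, so a large
  multiple of \<open>k\<close> makes \<open>h - g + C * k\<close> positive on all of \<open>K\<close>. Its minimum can then be taken out of
  the coefficient of \<open>h\<close>, because \<open>h \<le> 1\<close> on \<open>K\<close>.\<close>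

lemma compact_domination:
  fixes g h k :: "'z::topological_space \<Rightarrow> real"
  assumes K: "compact K" and cont: "continuous_on K g" "continuous_on K h" "continuous_on K k"
    and h: "\<And>z. z \<in> K \<Longrightarrow> 0 \<le> h z \<and> h z \<le> 1" and k: "\<And>z. z \<in> K \<Longrightarrow> 0 \<le> k z"
    and strict: "\<And>z. z \<in> K \<Longrightarrow> k z = 0 \<Longrightarrow> g z < h z"
  shows "\<exists>\<theta> C. 0 \<le> \<theta> \<and> \<theta> < 1 \<and> 0 \<le> C \<and> (\<forall>z\<in>K. g z \<le> \<theta> * h z + C * k z)"
proof (cases "K = {}")
  case True
  thus ?thesis by (intro exI[of _ 0]) auto
next
  case False
  have "\<exists>C\<ge>0. \<forall>z\<in>K. 0 < h z - g z + C * k z"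
  proof -
    define Z where "Z = {z \<in> K. h z - g z \<le> 0}"
    have "Z = K \<inter> {z \<in> K. h z - g z \<le> 0}" by (auto simp: Z_def)
    moreover have "closedin (top_of_set K) {z \<in> K. h z - g z \<le> 0}"
      using continuous_closedin_preimage[of K "\<lambda>z. h z - g z" "{..0}"] cont
      by (simp add: continuous_on_diff vimage_def Int_def)
    ultimately have Z: "compact Z"
      using K closedin_compact by (metis Int_absorb1 closedin_imp_subset)
    have ZK: "Z \<subseteq> K" by (auto simp: Z_def)
    show ?thesis
    proof (cases "Z = {}")
      case True
      hence "\<forall>z\<in>K. 0 < h z - g z" by (force simp: Z_def)
      thus ?thesis by (intro exI[of _ 0]) auto
    next
      case ne: False
      obtain z0 where z0: "z0 \<in> Z" "\<And>z. z \<in> Z \<Longrightarrow> k z0 \<le> k z"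
        using continuous_attains_inf[OF Z ne continuous_on_subset[OF cont(3) ZK]] by auto
      obtain z1 where z1: "z1 \<in> Z" "\<And>z. z \<in> Z \<Longrightarrow> g z - h z \<le> g z1 - h z1"
        using continuous_attains_sup[OF Z ne, of "\<lambda>z. g z - h z"]
          continuous_on_subset[OF cont(1) ZK] continuous_on_subset[OF cont(2) ZK]
        by (auto intro: continuous_on_diff)
      define C where "C = (g z1 - h z1 + 1) / k z0"
      have pos: "k z0 > 0" using strict[of z0] k[of z0] z0(1) by (force simp: Z_def)
      have B: "g z1 - h z1 \<ge> 0" using z1(1) by (simp add: Z_def)
      have C0: "C \<ge> 0" using pos B by (simp add: C_def)
      have "0 < h z - g z + C * k z" if "z \<in> K" for z
      proof (cases "z \<in> Z")
        case True
        have "g z1 - h z1 + 1 = C * k z0" using pos by (simp add: C_def)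
        also have "\<dots> \<le> C * k z" using C0 z0(2)[OF True] by (rule mult_left_mono[rotated])
        finally show ?thesis using z1(2)[OF True] by linarith
      next
        case False
        hence "0 < h z - g z" using that by (simp add: Z_def)
        thus ?thesis using mult_nonneg_nonneg[OF C0 k[OF that]] by linarith
      qed
      thus ?thesis using C0 by blast
    qed
  qed
  then obtain C where C: "C \<ge> 0" "\<And>z. z \<in> K \<Longrightarrow> 0 < h z - g z + C * k z" by blast
  obtain z0 where z0: "z0 \<in> K" "\<And>z. z \<in> K \<Longrightarrow> h z0 - g z0 + C * k z0 \<le> h z - g z + C * k z"
    using continuous_attains_inf[OF K False, of "\<lambda>z. h z - g z + C * k z"]
      continuous_on_add[OF continuous_on_diff[OF cont(2,1)] continuous_on_mult_left[OF cont(3), of C]]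
    by auto
  define e where "e = min 1 (h z0 - g z0 + C * k z0)"
  have e: "0 < e" "e \<le> 1" using C(2)[OF z0(1)] by (auto simp: e_def)
  have "g z \<le> (1 - e) * h z + C * k z" if "z \<in> K" for z
  proof -
    have "e * h z \<le> e" using h[OF that] e by (simp add: mult_left_le)
    also have "e \<le> h z - g z + C * k z" using z0(2)[OF that] by (simp add: e_def)
    finally show ?thesis by (simp add: algebra_simps)
  qed
  thus ?thesis using e C(1) by (intro exI[of _ "1 - e"] exI[of _ C]) auto
qed

lemma norm_le_mean_norm:
  fixes b :: "(real ^ 'l::finite) ^ 'm::finite"
  assumes "b \<in> V_pow"
  shows "norm x \<le> (\<Sum>j\<in>UNIV. norm (x + b $ j)) / real CARD('m)"
proof -
  have "real CARD('m) *\<^sub>R x = (\<Sum>j\<in>UNIV. x + b $ j)"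
    using assms by (simp add: V_pow_def sum.distrib sum_constant_scaleR del: sum_constant)
  hence "real CARD('m) * norm x = norm (\<Sum>j\<in>UNIV. x + b $ j)"
    by (metis norm_scaleR abs_of_nat)
  also have "\<dots> \<le> (\<Sum>j\<in>UNIV. norm (x + b $ j))" by (rule norm_sum)
  finally show ?thesis by (simp add: field_simps)
qed

text \<open>The only place where the structural condition enters. Without gain of mass, the triangle inequality
  \<open>\<Sum>\<^sub>j \<bar>x + b\<^sub>j\<bar> \<ge> \<bar>\<Sum>\<^sub>j (x + b\<^sub>j)\<bar> = m \<bar>x\<bar>\<close> is an equality, so the values on the children
  are \<open>m t\<^sub>j x\<close> with nonnegative weights \<open>t\<^sub>j\<close> of sum \<open>1\<close>, and the inequality reads
  \<open>\<Sum>\<^sub>j t\<^sub>j\<^sup>p < 1\<close>. It fails only for a point mass \<open>t\<close>, that is, when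
  \<open>b = v \<otimes> x\<close> with \<open>v\<close> equal to \<open>m - 1\<close> at one place and to \<open>-1\<close> elsewhere: exactly the
  vectors that are excluded from \<open>W\<close>.\<close>

lemma strict_decrease_without_mass_gain:
  fixes W :: "((real ^ 'l::finite) ^ 'm::finite) set"
  assumes m: "CARD('m) \<ge> 2" and WV: "W \<subseteq> V_pow" and ssc: "second_structural_condition W"
    and p: "1 < p" and b: "b \<in> W" and nz: "x \<noteq> 0 \<or> b \<noteq> 0"
    and eq: "(\<Sum>j\<in>UNIV. norm (x + b $ j)) / real CARD('m) = norm x"
  shows "(\<Sum>j\<in>UNIV. (norm (x + b $ j) / real CARD('m)) powr p) < norm x powr p"
proof -
  let ?m = "real CARD('m)"
  have m0: "?m > 0" by simp
  have sum_b: "(\<Sum>j\<in>UNIV. b $ j) = 0" using b WV by (auto simp: V_pow_def)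
  have sum_n: "(\<Sum>j\<in>UNIV. norm (x + b $ j)) = ?m * norm x" using eq by (simp add: field_simps)
  have x: "x \<noteq> 0"
  proof
    assume x0: "x = 0"
    hence "(\<Sum>j\<in>UNIV. norm (b $ j)) = 0" using sum_n by simp
    hence "\<forall>j. b $ j = 0" by (simp add: sum_nonneg_eq_0_iff)
    hence "b = 0" by (simp add: vec_eq_iff)
    thus False using nz x0 by simp
  qed
  define t where "t j = norm (x + b $ j) / (?m * norm x)" for j
  have t0: "0 \<le> t j" for j by (simp add: t_def)
  have t1: "(\<Sum>j\<in>UNIV. t j) = 1"
    using sum_n x by (simp add: t_def flip: sum_divide_distrib)
  have tle: "t j \<le> 1" for j using member_le_sum[of j UNIV t] t0 t1 by simp
  have nt: "norm (x + b $ j) / ?m = t j * norm x" for j using x by (simp add: t_def)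
  have dir: "x + b $ j = (?m * t j) *\<^sub>R x" for j
  proof -
    \<comment> \<open>The Cauchy-Schwarz inequalities against \<open>x\<close> add up to an equality, so each of them is one.\<close>
    have le: "(x + b $ j) \<bullet> x \<le> norm (x + b $ j) * norm x" for j by (rule norm_cauchy_schwarz)
    have "(\<Sum>j\<in>UNIV. norm (x + b $ j) * norm x - (x + b $ j) \<bullet> x)
        = (\<Sum>j\<in>UNIV. norm (x + b $ j)) * norm x - (\<Sum>j\<in>UNIV. x + b $ j) \<bullet> x"
      by (simp add: sum_subtractf sum_distrib_right inner_sum_left)
    also have "\<dots> = 0"
      using sum_b by (simp add: sum_n sum.distrib sum_constant_scaleR dot_square_norm power2_eq_square
          del: sum_constant)
    finally have "\<forall>j. norm (x + b $ j) * norm x - (x + b $ j) \<bullet> x = 0"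
      using le by (subst (asm) sum_nonneg_eq_0_iff) auto
    hence "norm (x + b $ j) *\<^sub>R x = norm x *\<^sub>R (x + b $ j)"
      using norm_cauchy_schwarz_eq[of "x + b $ j" x] by simp
    hence "inverse (norm x) *\<^sub>R (norm x *\<^sub>R (x + b $ j)) = inverse (norm x) *\<^sub>R (norm (x + b $ j) *\<^sub>R x)" by simp
    thus ?thesis using x by (simp add: t_def field_simps del: scaleR_right_distrib scaleR_add_right)
  qed
  have "\<exists>i. t i powr p < t i"
  proof (rule ccontr)
    assume H: "\<not> ?thesis"
    have t01: "t j = 0 \<or> t j = 1" for j
    proof (rule ccontr)
      assume "\<not> (t j = 0 \<or> t j = 1)"
      hence j: "0 < t j" "t j < 1" using t0[of j] tle[of j] by auto
      have "t j powr p < t j powr 1" by (intro powr_less_mono') (use j p in auto)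
      thus False using H j by auto
    qed
    obtain i where i: "t i = 1" using t01 t1 by (metis sum.neutral zero_neq_one)
    have others: "t j = 0" if "j \<noteq> i" for j
    proof -
      have "(\<Sum>j\<in>UNIV - {i}. t j) = 0" using t1 i by (simp add: sum.remove[of UNIV i])
      thus ?thesis using t0 that by (subst (asm) sum_nonneg_eq_0_iff) auto
    qed
    define v :: "real ^ 'm" where "v = (\<chi> j. if j = i then ?m - 1 else -1)"
    have bv: "b = tensor v x"
    proof (rule vec_eq_iff[THEN iffD2], rule allI)
      fix j show "b $ j = tensor v x $ j"
        using dir[of j] i others[of j]
        by (cases "j = i") (auto simp: tensor_def v_def algebra_simps eq_neg_iff_add_eq_0 eq_diff_eq)
    qed
    have "(\<Sum>j\<in>UNIV - {i}. v $ j) = - (?m - 1)"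
      by (simp add: v_def of_nat_diff)
    hence "v \<in> V_space" by (simp add: V_space_def sum.remove[of UNIV i] v_def)
    moreover have "card (UNIV - {i}) = CARD('m) - 1 \<and> (\<forall>j\<in>UNIV - {i}. v $ j = -1)"
      by (simp add: v_def card_Diff_singleton)
    moreover have "tensor v x \<noteq> 0"
    proof
      assume "tensor v x = 0"
      hence "tensor v x $ i = 0" by simp
      thus False using x m by (simp add: tensor_def v_def)
    qed
    ultimately show False using ssc b bv unfolding second_structural_condition_def by blast
  qed
  then obtain i where i: "t i powr p < t i" by blast
  have le: "t j powr p \<le> t j" for j
    using t0[of j] tle[of j] p powr_le_one_le[of "t j" p] by (cases "t j = 0") auto
  have "(\<Sum>j\<in>UNIV. t j powr p) < (\<Sum>j\<in>UNIV. t j)"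
    using le i by (intro sum_strict_mono_ex1) auto
  hence "(\<Sum>j\<in>UNIV. t j powr p) * norm x powr p < norm x powr p" using x t1 by simp
  thus ?thesis using t0 by (simp add: nt powr_mult sum_distrib_right)
qed

text \<open>Both sides are homogeneous of degree \<open>p\<close> in \<open>(x, b)\<close>. It is therefore enough to treat the unit
  sphere, where compactness turns the strict inequality above into one with a uniform \<open>\<theta> < 1\<close>.\<close>

lemma atom_inequality:
  fixes W :: "((real ^ 'l::finite) ^ 'm::finite) set"
  assumes m: "CARD('m) \<ge> 2" and W: "subspace W" and WV: "W \<subseteq> V_pow"
    and ssc: "second_structural_condition W" and p: "1 < p"
  shows "\<exists>\<theta> C. 0 \<le> \<theta> \<and> \<theta> < 1 \<and> 0 \<le> C \<and> (\<forall>x. \<forall>b\<in>W.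
    (\<Sum>j\<in>UNIV. (norm (x + b $ j) / real CARD('m)) powr p)
      \<le> \<theta> * norm x powr p + C * ((\<Sum>j\<in>UNIV. norm (x + b $ j)) / real CARD('m) - norm x) powr p)"
proof -
  let ?m = "real CARD('m)"
  define g where "g z = (\<Sum>j\<in>UNIV. (norm (fst z + snd z $ j) / ?m) powr p)"
    for z :: "(real ^ 'l) \<times> ((real ^ 'l) ^ 'm)"
  define h where "h z = norm (fst z) powr p" for z :: "(real ^ 'l) \<times> ((real ^ 'l) ^ 'm)"
  define gain where "gain z = (\<Sum>j\<in>UNIV. norm (fst z + snd z $ j)) / ?m - norm (fst z)"
    for z :: "(real ^ 'l) \<times> ((real ^ 'l) ^ 'm)"
  define k where "k z = gain z powr p" for z
  define K where "K = sphere (0 :: (real ^ 'l) \<times> ((real ^ 'l) ^ 'm)) 1 \<inter> (UNIV \<times> W)"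
  have K: "compact K" unfolding K_def
    by (intro compact_Int_closed compact_sphere closed_Times closed_UNIV closed_subspace W)
  have gain0: "0 \<le> gain z" if "snd z \<in> W" for z
    using norm_le_mean_norm[of "snd z" "fst z"] that WV by (auto simp: gain_def)
  have cont: "continuous_on K g" "continuous_on K h" "continuous_on K k"
    unfolding g_def h_def k_def
    using p gain0 by (auto intro!: continuous_intros continuous_on_powr' simp: gain_def K_def)
  have h1: "0 \<le> h z \<and> h z \<le> 1" if "z \<in> K" for z
  proof -
    have "norm (fst z) \<le> 1" using that norm_fst_le[of "fst z" "snd z"] by (simp add: K_def)
    thus ?thesis using p by (simp add: h_def powr_le1)
  qed
  have strict: "g z < h z" if "z \<in> K" "k z = 0" for z
  proof -
    have "z \<noteq> 0" "snd z \<in> W" using that by (auto simp: K_def)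
    moreover have "gain z = 0" using that by (simp add: k_def)
    ultimately show ?thesis
      using strict_decrease_without_mass_gain[OF m WV ssc p, of "snd z" "fst z"]
      by (auto simp: gain_def g_def h_def prod_eq_iff)
  qed
  obtain \<theta> C where \<theta>: "0 \<le> \<theta>" "\<theta> < 1" "0 \<le> C"
      and le: "\<And>z. z \<in> K \<Longrightarrow> g z \<le> \<theta> * h z + C * k z"
    using compact_domination[OF K cont h1 _ strict] by (auto simp: k_def)
  have "g z \<le> \<theta> * h z + C * k z" if z: "snd z \<in> W" for z
  proof (cases "z = 0")
    case True
    thus ?thesis by (simp add: g_def h_def k_def gain_def)
  next
    case False
    define r where "r = norm z"
    define y where "y = inverse r *\<^sub>R z"
    have r: "r > 0" using False by (simp add: r_def)
    have zy: "z = r *\<^sub>R y" using r by (simp add: y_def)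
    have yW: "snd y \<in> W" using W z by (simp add: y_def subspace_scale)
    have y: "y \<in> K" using yW r by (simp add: K_def y_def r_def mem_Times_iff)
    have nrm: "norm (fst z + snd z $ j) = r * norm (fst y + snd y $ j)" for j
      using r unfolding zy by (simp flip: scaleR_add_right)
    have gz: "g z = r powr p * g y"
      using r by (simp add: g_def nrm powr_mult sum_distrib_left flip: times_divide_eq_right)
    have hz: "h z = r powr p * h y" using r by (simp add: h_def zy powr_mult)
    have "(\<Sum>j\<in>UNIV. norm (fst z + snd z $ j)) = r * (\<Sum>j\<in>UNIV. norm (fst y + snd y $ j))"
      by (simp add: nrm sum_distrib_left)
    moreover have "norm (fst z) = r * norm (fst y)" using r by (simp add: zy)
    ultimately have "gain z = r * gain y" by (simp add: gain_def right_diff_distrib)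
    hence kz: "k z = r powr p * k y" using r gain0[OF yW] by (simp add: k_def powr_mult)
    have "r powr p * g y \<le> r powr p * (\<theta> * h y + C * k y)"
      by (intro mult_left_mono le y) simp
    thus ?thesis by (simp add: gz hz kz algebra_simps)
  qed
  from this[of "(x, b)" for x b] show ?thesis
    using \<theta> by (intro exI[of _ \<theta>] exI[of _ C]) (auto simp: g_def h_def k_def gain_def)
qed

section \<open>Atoms of a uniform filtration\<close>

context uniform_filtration
begin

lemma sets_F_M: "A \<in> sets (\<F> n) \<Longrightarrow> A \<in> sets M"
  using subalg[of n] by (auto simp: subalgebra_def)

lemma space_F_M [simp]: "space (\<F> n) = space M"
  by (rule space_F)

lemma atom_sets: "\<omega> \<in> atoms (\<F> n) \<Longrightarrow> \<omega> \<in> sets (\<F> n)"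
  by (simp add: atoms_def)

lemma atom_ne: "\<omega> \<in> atoms (\<F> n) \<Longrightarrow> \<omega> \<noteq> {}"
  by (simp add: atoms_def)

lemma finite_atoms: "finite (atoms (\<F> n))"
  by (rule finite_subset[OF _ finite_alg[of n]]) (auto simp: atoms_def)

lemma finite_children: "finite (children \<F> n \<omega>)"
  by (rule finite_subset[OF _ finite_atoms[of "Suc n"]]) (auto simp: children_def)

lemma atom_subset:
  assumes "\<omega> \<in> atoms (\<F> n)" "A \<in> sets (\<F> n)" "x \<in> \<omega>" "x \<in> A"
  shows "\<omega> \<subseteq> A"
proof -
  have "A \<inter> \<omega> \<in> sets (\<F> n)" using assms(2) atom_sets[OF assms(1)] by (rule sets.Int)
  hence "A \<inter> \<omega> = {} \<or> A \<inter> \<omega> = \<omega>" using assms(1) by (simp add: atoms_def)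
  thus ?thesis using assms(3,4) by blast
qed

lemma atoms_eqI:
  assumes "\<omega> \<in> atoms (\<F> n)" "\<omega>' \<in> atoms (\<F> n)" "x \<in> \<omega>" "x \<in> \<omega>'"
  shows "\<omega> = \<omega>'"
  using atom_subset[OF assms(1) atom_sets[OF assms(2)] assms(3,4)]
    atom_subset[OF assms(2) atom_sets[OF assms(1)] assms(4,3)] by (rule equalityI)

text \<open>The atom that contains \<open>x\<close> is the intersection of all events of the algebra that contain \<open>x\<close>.\<close>

lemma obtain_atom:
  assumes "x \<in> space M"
  obtains \<omega> where "\<omega> \<in> atoms (\<F> n)" "x \<in> \<omega>"
proof -
  define \<omega> where "\<omega> = (\<Inter>A\<in>{A \<in> sets (\<F> n). x \<in> A}. A)"
  have "space M \<in> sets (\<F> n)" using sets.top[of "\<F> n"] by simp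
  hence "{A \<in> sets (\<F> n). x \<in> A} \<noteq> {}" using assms by blast
  moreover have "finite {A \<in> sets (\<F> n). x \<in> A}"
    by (rule finite_subset[OF _ finite_alg[of n]]) auto
  ultimately have s: "\<omega> \<in> sets (\<F> n)" unfolding \<omega>_def
    by (intro sets.finite_INT) blast+
  have x: "x \<in> \<omega>" by (simp add: \<omega>_def)
  have "B = {} \<or> B = \<omega>" if B: "B \<in> sets (\<F> n)" "B \<subseteq> \<omega>" for B
  proof (cases "x \<in> B")
    case True
    hence "\<omega> \<subseteq> B" using B by (auto simp: \<omega>_def)
    thus ?thesis using B by blast
  next
    case False
    moreover have "\<omega> - B \<in> sets (\<F> n)" using B s by (intro sets.Diff)
    ultimately have "\<omega> \<subseteq> \<omega> - B" using x unfolding \<omega>_def by blast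
    thus ?thesis using B by blast
  qed
  with s x have "\<omega> \<in> atoms (\<F> n)" unfolding atoms_def by auto
  thus ?thesis using x by (rule that)
qed

lemma Union_atoms: "\<Union> (atoms (\<F> n)) = space M"
proof
  show "\<Union> (atoms (\<F> n)) \<subseteq> space M"
    using sets.sets_into_space[OF atom_sets[of _ n]] by auto
  show "space M \<subseteq> \<Union> (atoms (\<F> n))" using obtain_atom by blast
qed

lemma atoms_Suc: "atoms (\<F> (Suc n)) = (\<Union>\<omega>\<in>atoms (\<F> n). children \<F> n \<omega>)"
proof
  show "atoms (\<F> (Suc n)) \<subseteq> (\<Union>\<omega>\<in>atoms (\<F> n). children \<F> n \<omega>)"
  proof
    fix \<omega>' assume \<omega>': "\<omega>' \<in> atoms (\<F> (Suc n))"
    then obtain x where x: "x \<in> \<omega>'" using atom_ne by blast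
    moreover have "x \<in> space M" using x \<omega>' Union_atoms by blast
    ultimately obtain \<omega> where \<omega>: "\<omega> \<in> atoms (\<F> n)" "x \<in> \<omega>" using obtain_atom by blast
    have "\<omega> \<in> sets (\<F> (Suc n))" using atom_sets[OF \<omega>(1)] sets_F_mono[of n "Suc n"] by auto
    hence "\<omega>' \<subseteq> \<omega>" using atom_subset[OF \<omega>'] x \<omega> by blast
    thus "\<omega>' \<in> (\<Union>\<omega>\<in>atoms (\<F> n). children \<F> n \<omega>)" using \<omega> \<omega>' by (auto simp: children_def)
  qed
qed (auto simp: children_def)

lemma children_disjoint:
  assumes "\<omega> \<in> atoms (\<F> n)" "\<omega>' \<in> atoms (\<F> n)" "\<omega> \<noteq> \<omega>'"
  shows "children \<F> n \<omega> \<inter> children \<F> n \<omega>' = {}"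
proof (rule ccontr)
  assume "\<not> ?thesis"
  then obtain \<omega>'' where \<omega>'': "\<omega>'' \<in> atoms (\<F> (Suc n))" "\<omega>'' \<subseteq> \<omega>" "\<omega>'' \<subseteq> \<omega>'"
    by (auto simp: children_def)
  then obtain x where "x \<in> \<omega>''" using atom_ne[OF \<omega>''(1)] by blast
  thus False using atoms_eqI[OF assms(1,2), of x] \<omega>'' assms(3) by blast
qed

lemma Union_children:
  assumes "\<omega> \<in> atoms (\<F> n)"
  shows "\<Union> (children \<F> n \<omega>) = \<omega>"
proof
  show "\<omega> \<subseteq> \<Union> (children \<F> n \<omega>)"
  proof
    fix x assume x: "x \<in> \<omega>"
    hence "x \<in> space M" using assms Union_atoms by blast
    then obtain \<omega>' where \<omega>': "\<omega>' \<in> atoms (\<F> (Suc n))" "x \<in> \<omega>'" using obtain_atom by blast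
    have "\<omega> \<in> sets (\<F> (Suc n))" using atom_sets[OF assms] sets_F_mono[of n "Suc n"] by auto
    thus "x \<in> \<Union> (children \<F> n \<omega>)"
      using \<omega>' atom_subset[OF \<omega>'(1) _ \<omega>'(2) x] by (auto simp: children_def)
  qed
qed (auto simp: children_def)

lemma m_pos: "0 < m"
proof -
  obtain x where "x \<in> space M" using not_empty by blast
  then obtain \<omega> where \<omega>: "\<omega> \<in> atoms (\<F> 0)" using obtain_atom by blast
  hence "children \<F> 0 \<omega> \<noteq> {}" using Union_children[OF \<omega>] atom_ne[OF \<omega>] by auto
  thus ?thesis using card_children[OF \<omega>] finite_children by (metis card_gt_0_iff)
qed

lemma prob_child:
  assumes \<omega>: "\<omega> \<in> atoms (\<F> n)" and \<omega>': "\<omega>' \<in> children \<F> n \<omega>"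
  shows "prob \<omega>' = prob \<omega> / real m"
proof -
  have "prob (\<Union>A\<in>children \<F> n \<omega>. A) = (\<Sum>A\<in>children \<F> n \<omega>. prob A)"
  proof (rule finite_measure_finite_Union[OF finite_children])
    show "(\<lambda>A. A) ` children \<F> n \<omega> \<subseteq> events"
      using sets_F_M[OF atom_sets[of _ "Suc n"]] by (auto simp: children_def)
    show "disjoint_family_on (\<lambda>A. A) (children \<F> n \<omega>)"
      unfolding disjoint_family_on_def children_def using atoms_eqI[of _ "Suc n"] by blast
  qed
  also have "\<dots> = (\<Sum>A\<in>children \<F> n \<omega>. prob \<omega>')"
    by (intro sum.cong refl equal_prob[OF \<omega> _ \<omega>'])
  finally show ?thesis using Union_children[OF \<omega>] card_children[OF \<omega>] m_pos by simp
qed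

lemma prob_atom: "\<omega> \<in> atoms (\<F> n) \<Longrightarrow> prob \<omega> = 1 / real m ^ n"
proof (induction n arbitrary: \<omega>)
  case 0
  hence "\<omega> = space M" using atom_sets[of \<omega> 0] atom_ne[of \<omega> 0] by (simp add: trivial_0)
  thus ?case by (simp add: prob_space)
next
  case (Suc n)
  then obtain \<omega>0 where "\<omega>0 \<in> atoms (\<F> n)" "\<omega> \<in> children \<F> n \<omega>0" using atoms_Suc by blast
  thus ?case using prob_child[of \<omega>0 n \<omega>] Suc.IH[of \<omega>0] by simp
qed

text \<open>Intended for \<open>f\<close> measurable with respect to \<open>\<F> n\<close> and \<open>\<omega>\<close> an atom of \<open>\<F> n\<close>: then \<open>f\<close> is
  constant on \<open>\<omega>\<close>, so this is its value there, whichever point is chosen.\<close>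

definition val :: "('a \<Rightarrow> 'b) \<Rightarrow> 'a set \<Rightarrow> 'b" where
  "val f \<omega> = f (SOME x. x \<in> \<omega>)"

lemma val_in: "\<omega> \<in> atoms (\<F> n) \<Longrightarrow> (SOME x. x \<in> \<omega>) \<in> \<omega>"
  using atom_ne by (simp add: some_in_eq)

lemma eq_val:
  fixes f :: "'a \<Rightarrow> 'v::euclidean_space"
  assumes f: "f \<in> borel_measurable (\<F> n)" and \<omega>: "\<omega> \<in> atoms (\<F> n)" and x: "x \<in> \<omega>"
  shows "f x = val f \<omega>"
proof -
  have sub: "\<omega> \<subseteq> space M" using \<omega> Union_atoms by blast
  have "f -` {val f \<omega>} \<inter> space (\<F> n) \<in> sets (\<F> n)"
    using f by (rule measurable_sets) simp
  hence "\<omega> \<subseteq> f -` {val f \<omega>} \<inter> space M"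
    using val_in[OF \<omega>] sub by (intro atom_subset[OF \<omega>, of _ "SOME x. x \<in> \<omega>"]) (auto simp: val_def)
  thus ?thesis using x by auto
qed

lemma has_bochner_integral_atoms:
  fixes g :: "'a \<Rightarrow> 'v::euclidean_space"
  assumes g: "\<And>\<omega> x. \<omega> \<in> atoms (\<F> n) \<Longrightarrow> x \<in> \<omega> \<Longrightarrow> g x = c \<omega>"
  shows "has_bochner_integral M g (\<Sum>\<omega>\<in>atoms (\<F> n). (1 / real m ^ n) *\<^sub>R c \<omega>)"
proof -
  have eq: "g x = (\<Sum>\<omega>\<in>atoms (\<F> n). indicator \<omega> x *\<^sub>R c \<omega>)" if x: "x \<in> space M" for x
  proof -
    obtain \<omega> where \<omega>: "\<omega> \<in> atoms (\<F> n)" "x \<in> \<omega>" using x obtain_atom by blast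
    have "(\<Sum>\<omega>'\<in>atoms (\<F> n). indicator \<omega>' x *\<^sub>R c \<omega>') = indicator \<omega> x *\<^sub>R c \<omega>"
      using atoms_eqI[OF \<omega>(1) _ \<omega>(2)]
      by (subst sum.mono_neutral_right[of _ "{\<omega>}"]) (auto simp: finite_atoms \<omega> indicator_def)
    thus ?thesis using g[OF \<omega>] \<omega>(2) by simp
  qed
  have ind: "has_bochner_integral M (\<lambda>x. indicator \<omega> x *\<^sub>R c \<omega>) ((1 / real m ^ n) *\<^sub>R c \<omega>)"
    if \<omega>: "\<omega> \<in> atoms (\<F> n)" for \<omega>
    using has_bochner_integral_real_indicator[of \<omega> M] sets_F_M[OF atom_sets[OF \<omega>]] prob_atom[OF \<omega>]
    by (intro has_bochner_integral_scaleR_left) (simp add: emeasure_eq_measure)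
  have "has_bochner_integral M (\<lambda>x. \<Sum>\<omega>\<in>atoms (\<F> n). indicator \<omega> x *\<^sub>R c \<omega>)
      (\<Sum>\<omega>\<in>atoms (\<F> n). (1 / real m ^ n) *\<^sub>R c \<omega>)"
    by (intro has_bochner_integral_sum ind)
  thus ?thesis by (simp only: has_bochner_integral_cong[OF refl eq refl])
qed

text \<open>\<open>mass n f\<close> and \<open>energy p n f\<close> are the total variation and the \<open>p\<close>-th power of the \<open>\<ell>\<^sup>p\<close>-norm of the
  vector measure with density \<open>f\<close>, regarded as a function on the atoms of level \<open>n\<close>, which have
  probability \<open>m\<^sup>-\<^sup>n\<close>.\<close>

definition mass :: "nat \<Rightarrow> ('a \<Rightarrow> 'v::euclidean_space) \<Rightarrow> real" where
  "mass n f = (\<Sum>\<omega>\<in>atoms (\<F> n). norm (val f \<omega>) / real m ^ n)"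

definition energy :: "real \<Rightarrow> nat \<Rightarrow> ('a \<Rightarrow> 'v::euclidean_space) \<Rightarrow> real" where
  "energy p n f = (\<Sum>\<omega>\<in>atoms (\<F> n). (norm (val f \<omega>) / real m ^ n) powr p)"

lemma mass_nonneg: "0 \<le> mass n f"
  by (simp add: mass_def sum_nonneg)

lemma energy_nonneg: "0 \<le> energy p n f"
  by (simp add: energy_def sum_nonneg)

lemma energy_le_mass_powr:
  assumes "1 \<le> p"
  shows "energy p n f \<le> mass n f powr p"
  unfolding energy_def mass_def using assms by (intro sum_powr_le_powr_sum finite_atoms) auto

lemma nn_integral_norm_eq_mass:
  fixes f :: "'a \<Rightarrow> 'v::euclidean_space"
  assumes "f \<in> borel_measurable (\<F> n)"
  shows "(\<integral>\<^sup>+x. ennreal (norm (f x)) \<partial>M) = ennreal (mass n f)"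
proof -
  have *: "has_bochner_integral M (\<lambda>x. norm (f x))
      (\<Sum>\<omega>\<in>atoms (\<F> n). (1 / real m ^ n) *\<^sub>R norm (val f \<omega>))"
    by (rule has_bochner_integral_atoms) (simp add: eq_val[OF assms])
  have "(\<integral>\<^sup>+x. ennreal (norm (f x)) \<partial>M) = ennreal (LINT x|M. norm (f x))"
    using * by (intro nn_integral_eq_integral) (auto simp: has_bochner_integral_iff)
  thus ?thesis using * by (simp add: has_bochner_integral_iff mass_def)
qed

text \<open>The reason for the exponent \<open>(p - 1) / p\<close>: the weight of the Besov norm converts the \<open>L\<^sup>p\<close>-norm of a
  density at level \<open>n\<close> into the \<open>\<ell>\<^sup>p\<close>-norm of the masses of the atoms.\<close>

lemma scaled_Lp_norm_eq_energy:
  fixes f :: "'a \<Rightarrow> 'v::euclidean_space"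
  assumes f: "f \<in> borel_measurable (\<F> n)" and p: "1 < p"
  shows "real m powr (- ((p - 1) / p) * real n) * Lp_norm M p f = energy p n f powr (1 / p)"
proof -
  have "has_bochner_integral M (\<lambda>x. norm (f x) powr p)
      (\<Sum>\<omega>\<in>atoms (\<F> n). (1 / real m ^ n) *\<^sub>R (norm (val f \<omega>) powr p))"
    by (rule has_bochner_integral_atoms) (simp add: eq_val[OF f])
  hence int: "(LINT x|M. norm (f x) powr p) = (\<Sum>\<omega>\<in>atoms (\<F> n). norm (val f \<omega>) powr p / real m ^ n)"
    by (simp add: has_bochner_integral_iff)
  have scale: "real m powr (- (p - 1) * real n) / real m ^ n = 1 / (real m ^ n) powr p"
  proof -
    have "real m powr (- (p - 1) * real n) / real m powr real n
        = real m powr (- (p - 1) * real n - real n)"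
      by (simp only: powr_diff)
    also have "- (p - 1) * real n - real n = - (real n * p)" by (simp add: algebra_simps)
    also have "real m powr - (real n * p) = 1 / (real m powr real n) powr p"
      by (simp only: powr_minus_divide powr_powr)
    finally show ?thesis using m_pos by (simp only: powr_realpow of_nat_0_less_iff)
  qed
  have summand: "(norm (val f \<omega>) / real m ^ n) powr p
      = real m powr (- (p - 1) * real n) * (norm (val f \<omega>) powr p / real m ^ n)" for \<omega>
  proof -
    have "(norm (val f \<omega>) / real m ^ n) powr p = norm (val f \<omega>) powr p * (1 / (real m ^ n) powr p)"
      by (simp add: powr_divide)
    thus ?thesis unfolding scale[symmetric] by simp
  qed
  have "energy p n f = real m powr (- (p - 1) * real n) * (LINT x|M. norm (f x) powr p)"
    by (simp only: energy_def summand int sum_distrib_left)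
  hence "energy p n f powr (1 / p)
      = (real m powr (- (p - 1) * real n)) powr (1 / p) * (LINT x|M. norm (f x) powr p) powr (1 / p)"
    by (simp add: powr_mult)
  also have "(real m powr (- (p - 1) * real n)) powr (1 / p) = real m powr (- ((p - 1) / p) * real n)"
  proof -
    have "- (p - 1) * real n * (1 / p) = - ((p - 1) / p) * real n"
      using p by (simp add: field_simps)
    thus ?thesis by (simp only: powr_powr)
  qed
  finally show ?thesis by (simp add: Lp_norm_def)
qed

lemma measurable_F_mono:
  fixes f :: "'a \<Rightarrow> 'v::euclidean_space"
  assumes "f \<in> borel_measurable (\<F> k)" "k \<le> n"
  shows "f \<in> borel_measurable (\<F> n)"
  using assms sets_F_mono[OF assms(2)] by (auto simp: measurable_def)

end

section \<open>The embedding into the Besov space\<close>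

locale structured_filtration = uniform_filtration M \<F> "CARD('m)"
  for M :: "'a measure" and \<F> :: "nat \<Rightarrow> 'a measure"
    and J :: "nat \<Rightarrow> 'a set \<Rightarrow> 'm::finite \<Rightarrow> 'a set"
    and W :: "((real ^ 'l::finite) ^ 'm) set" and p :: real +
  assumes two_le_m: "CARD('m) \<ge> 2"
    and J: "\<And>n \<omega>. \<omega> \<in> atoms (\<F> n) \<Longrightarrow> bij_betw (J n \<omega>) UNIV (children \<F> n \<omega>)"
    and W: "subspace W" "W \<subseteq> V_pow" "second_structural_condition W"
    and p: "1 < p"
begin

lemma W_space_measurable:
  assumes "X \<in> W_space M \<F> J W"
  shows "X n \<in> borel_measurable (\<F> n)"
  using assms by (simp add: W_space_def L1_space_def martingale_def)

lemma mdiff_measurable: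
  assumes "X \<in> W_space M \<F> J W"
  shows "mdiff X n \<in> borel_measurable (\<F> n)"
proof (cases n)
  case 0
  thus ?thesis using W_space_measurable[OF assms] by simp
next
  case (Suc k)
  have "X k \<in> borel_measurable (\<F> (Suc k))"
    by (rule measurable_F_mono[OF W_space_measurable[OF assms]]) simp
  thus ?thesis using W_space_measurable[OF assms] Suc by simp
qed

lemma J_atom:
  assumes "\<omega> \<in> atoms (\<F> n)"
  shows "J n \<omega> j \<in> atoms (\<F> (Suc n))" "J n \<omega> j \<subseteq> \<omega>"
  using bij_betwE[OF J[OF assms]] by (auto simp: children_def)

lemma sum_atoms_Suc:
  "(\<Sum>\<omega>\<in>atoms (\<F> (Suc n)). g \<omega>) = (\<Sum>\<omega>\<in>atoms (\<F> n). \<Sum>j\<in>UNIV. g (J n \<omega> j))"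
proof -
  have "(\<Sum>\<omega>\<in>atoms (\<F> (Suc n)). g \<omega>) = (\<Sum>\<omega>\<in>atoms (\<F> n). \<Sum>\<omega>'\<in>children \<F> n \<omega>. g \<omega>')"
    unfolding atoms_Suc using children_disjoint
    by (intro sum.UNION_disjoint) (auto simp: finite_atoms finite_children)
  also have "\<dots> = (\<Sum>\<omega>\<in>atoms (\<F> n). \<Sum>j\<in>UNIV. g (J n \<omega> j))"
    by (intro sum.cong refl sum.reindex_bij_betw[symmetric] J)
  finally show ?thesis .
qed

lemma child_fun_J:
  assumes \<omega>: "\<omega> \<in> atoms (\<F> n)" and x: "x \<in> J n \<omega> j"
  shows "child_fun (J n \<omega>) b x = b $ j"
proof -
  have notin: "x \<notin> J n \<omega> i" if "i \<noteq> j" for i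
  proof
    assume "x \<in> J n \<omega> i"
    hence "J n \<omega> i = J n \<omega> j" by (intro atoms_eqI[OF J_atom(1)[OF \<omega>] J_atom(1)[OF \<omega>] _ x])
    thus False using that J[OF \<omega>] by (auto simp: bij_betw_def inj_def)
  qed
  have "child_fun (J n \<omega>) b x = (\<Sum>i\<in>{j}. indicator (J n \<omega> i) x *\<^sub>R (b $ i))"
    unfolding child_fun_def by (rule sum.mono_neutral_right) (auto simp: notin indicator_def)
  thus ?thesis using x by simp
qed

lemma child_values:
  assumes X: "X \<in> W_space M \<F> J W" and \<omega>: "\<omega> \<in> atoms (\<F> n)"
  shows "\<exists>b\<in>W. \<forall>j. val (X (Suc n)) (J n \<omega> j) = val (X n) \<omega> + b $ j \<and>
    val (mdiff X (Suc n)) (J n \<omega> j) = b $ j"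
proof -
  obtain b where b: "b \<in> W" "\<And>x. x \<in> \<omega> \<Longrightarrow> mdiff X (Suc n) x = child_fun (J n \<omega>) b x"
    using X \<omega> unfolding W_space_def by blast
  have "val (X (Suc n)) (J n \<omega> j) = val (X n) \<omega> + b $ j \<and>
    val (mdiff X (Suc n)) (J n \<omega> j) = b $ j" for j
  proof -
    define y where "y = (SOME x. x \<in> J n \<omega> j)"
    have y: "y \<in> J n \<omega> j" unfolding y_def by (rule val_in[OF J_atom(1)[OF \<omega>]])
    hence y\<omega>: "y \<in> \<omega>" using J_atom(2)[OF \<omega>] by blast
    have d: "mdiff X (Suc n) y = b $ j" using b(2)[OF y\<omega>] child_fun_J[OF \<omega> y] by simp
    have "X n y = val (X n) \<omega>" by (rule eq_val[OF W_space_measurable[OF X] \<omega> y\<omega>])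
    thus ?thesis using d by (simp add: val_def flip: y_def) (simp add: algebra_simps)
  qed
  thus ?thesis using b(1) by blast
qed

text \<open>The growth of the total variation of the associated vector measure when the atom \<open>\<omega>\<close> is split.\<close>

definition mass_gain :: "(nat \<Rightarrow> 'a \<Rightarrow> real ^ 'l) \<Rightarrow> nat \<Rightarrow> 'a set \<Rightarrow> real" where
  "mass_gain X n \<omega> =
    ((\<Sum>j\<in>UNIV. norm (val (X (Suc n)) (J n \<omega> j))) / real CARD('m) - norm (val (X n) \<omega>)) / real CARD('m) ^ n"

lemma mass_gain_nonneg:
  assumes X: "X \<in> W_space M \<F> J W" and \<omega>: "\<omega> \<in> atoms (\<F> n)"
  shows "0 \<le> mass_gain X n \<omega>"
proof -
  obtain b where b: "b \<in> W" "\<And>j. val (X (Suc n)) (J n \<omega> j) = val (X n) \<omega> + b $ j"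
    using child_values[OF X \<omega>] by blast
  have "b \<in> V_pow" using b(1) W(2) by blast
  from norm_le_mean_norm[OF this, of "val (X n) \<omega>"] show ?thesis
    unfolding mass_gain_def b(2) by (intro divide_nonneg_nonneg) auto
qed

lemma sum_mass_gain:
  "(\<Sum>\<omega>\<in>atoms (\<F> n). mass_gain X n \<omega>) = mass (Suc n) (X (Suc n)) - mass n (X n)"
proof -
  have "mass (Suc n) (X (Suc n)) = (\<Sum>\<omega>\<in>atoms (\<F> n).
      (\<Sum>j\<in>UNIV. norm (val (X (Suc n)) (J n \<omega> j))) / real CARD('m) / real CARD('m) ^ n)"
    unfolding mass_def by (simp add: sum_atoms_Suc sum_divide_distrib)
  thus ?thesis
    unfolding mass_def mass_gain_def by (simp add: diff_divide_distrib sum_subtractf)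
qed

text \<open>The inequality \<open>atom\<close> is applied on every atom of level \<open>n\<close>. As \<open>p \<ge> 1\<close>, the \<open>p\<close>-th powers of the
  local gains add up to at most the \<open>p\<close>-th power of the total gain.\<close>

lemma energy_step:
  assumes \<theta>: "0 \<le> \<theta>" "0 \<le> C" and X: "X \<in> W_space M \<F> J W"
    and atom: "\<And>x b. b \<in> W \<Longrightarrow>
      (\<Sum>j\<in>UNIV. (norm (x + b $ j) / real CARD('m)) powr p)
      \<le> \<theta> * norm x powr p + C * ((\<Sum>j\<in>UNIV. norm (x + b $ j)) / real CARD('m) - norm x) powr p"
  shows "energy p (Suc n) (X (Suc n))
    \<le> \<theta> * energy p n (X n) + C * (mass (Suc n) (X (Suc n)) - mass n (X n)) powr p"
proof -
  let ?m = "real CARD('m)"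
  have step: "(\<Sum>j\<in>UNIV. (norm (val (X (Suc n)) (J n \<omega> j)) / ?m ^ Suc n) powr p)
      \<le> \<theta> * (norm (val (X n) \<omega>) / ?m ^ n) powr p + C * mass_gain X n \<omega> powr p"
    if \<omega>: "\<omega> \<in> atoms (\<F> n)" for \<omega>
  proof -
    obtain b where b: "b \<in> W" "\<And>j. val (X (Suc n)) (J n \<omega> j) = val (X n) \<omega> + b $ j"
      using child_values[OF X \<omega>] by blast
    define x where "x = val (X n) \<omega>"
    define A where "A = (\<Sum>j\<in>UNIV. norm (x + b $ j)) / ?m - norm x"
    have A0: "0 \<le> A" using norm_le_mean_norm[of b x] b(1) W(2) by (auto simp: A_def)
    have "(\<Sum>j\<in>UNIV. (norm (val (X (Suc n)) (J n \<omega> j)) / ?m ^ Suc n) powr p)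
        = (\<Sum>j\<in>UNIV. (norm (x + b $ j) / ?m) powr p) / (?m ^ n) powr p"
      unfolding b(2) x_def by (simp add: powr_divide powr_mult sum_divide_distrib)
    also have "\<dots> \<le> (\<theta> * norm x powr p + C * A powr p) / (?m ^ n) powr p"
      unfolding A_def by (intro divide_right_mono atom b(1)) simp
    also have "\<dots> = \<theta> * (norm x / ?m ^ n) powr p + C * (A / ?m ^ n) powr p"
      using A0 by (simp add: powr_divide add_divide_distrib)
    also have "A / ?m ^ n = mass_gain X n \<omega>" unfolding mass_gain_def b(2) A_def x_def ..
    finally show ?thesis by (simp add: x_def)
  qed
  have "energy p (Suc n) (X (Suc n))
      \<le> (\<Sum>\<omega>\<in>atoms (\<F> n). \<theta> * (norm (val (X n) \<omega>) / ?m ^ n) powr p + C * mass_gain X n \<omega> powr p)"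
    unfolding energy_def sum_atoms_Suc by (intro sum_mono step)
  also have "\<dots> = \<theta> * energy p n (X n) + C * (\<Sum>\<omega>\<in>atoms (\<F> n). mass_gain X n \<omega> powr p)"
    by (simp add: energy_def sum.distrib sum_distrib_left)
  also have "\<dots> \<le> \<theta> * energy p n (X n) + C * (\<Sum>\<omega>\<in>atoms (\<F> n). mass_gain X n \<omega>) powr p"
    using p by (intro add_left_mono mult_left_mono[OF _ \<theta>(2)] sum_powr_le_powr_sum finite_atoms mass_gain_nonneg[OF X]) auto
  finally show ?thesis by (simp only: sum_mass_gain)
qed

lemma mass_mono:
  assumes X: "X \<in> W_space M \<F> J W"
  shows "mass n (X n) \<le> mass (Suc n) (X (Suc n))"
  using sum_nonneg[of "atoms (\<F> n)" "mass_gain X n"] mass_gain_nonneg[OF X] sum_mass_gain[of X n] by simp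

text \<open>The jump is the value on the child minus the value on the parent. The latter, spread over the \<open>m\<close>
  children, does not increase the energy, because splitting a mass into \<open>m\<close> parts does not.\<close>

lemma energy_mdiff_le:
  assumes X: "X \<in> W_space M \<F> J W"
  shows "energy p (Suc n) (mdiff X (Suc n)) \<le> 2 powr p * (energy p (Suc n) (X (Suc n)) + energy p n (X n))"
proof -
  let ?m = "real CARD('m)"
  have step: "(\<Sum>j\<in>UNIV. (norm (val (mdiff X (Suc n)) (J n \<omega> j)) / ?m ^ Suc n) powr p)
      \<le> 2 powr p * ((\<Sum>j\<in>UNIV. (norm (val (X (Suc n)) (J n \<omega> j)) / ?m ^ Suc n) powr p)
        + (norm (val (X n) \<omega>) / ?m ^ n) powr p)"
    if \<omega>: "\<omega> \<in> atoms (\<F> n)" for \<omega>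
  proof -
    obtain b where b: "b \<in> W" "\<And>j. val (X (Suc n)) (J n \<omega> j) = val (X n) \<omega> + b $ j"
      "\<And>j. val (mdiff X (Suc n)) (J n \<omega> j) = b $ j"
      using child_values[OF X \<omega>] by blast
    define x where "x = val (X n) \<omega>"
    have "(norm (b $ j) / ?m ^ Suc n) powr p
        \<le> 2 powr p * ((norm (x + b $ j) / ?m ^ Suc n) powr p + (norm x / ?m ^ Suc n) powr p)" for j
    proof -
      have "norm (b $ j) \<le> norm (x + b $ j) + norm x"
        using norm_triangle_ineq4[of "x + b $ j" x] by simp
      hence "norm (b $ j) / ?m ^ Suc n \<le> norm (x + b $ j) / ?m ^ Suc n + norm x / ?m ^ Suc n"
        by (simp add: divide_right_mono flip: add_divide_distrib)
      hence "(norm (b $ j) / ?m ^ Suc n) powr p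
          \<le> (norm (x + b $ j) / ?m ^ Suc n + norm x / ?m ^ Suc n) powr p"
        using p by (intro powr_mono2) auto
      also have "\<dots> \<le> 2 powr p * ((norm (x + b $ j) / ?m ^ Suc n) powr p + (norm x / ?m ^ Suc n) powr p)"
        using p by (intro powr_add_le_two_powr) auto
      finally show ?thesis .
    qed
    hence "(\<Sum>j\<in>UNIV. (norm (b $ j) / ?m ^ Suc n) powr p)
        \<le> (\<Sum>j\<in>UNIV. 2 powr p * ((norm (x + b $ j) / ?m ^ Suc n) powr p + (norm x / ?m ^ Suc n) powr p))"
      by (intro sum_mono)
    also have "\<dots> = 2 powr p * ((\<Sum>j\<in>UNIV. (norm (x + b $ j) / ?m ^ Suc n) powr p)
        + (\<Sum>j\<in>(UNIV :: 'm set). (norm x / ?m ^ Suc n) powr p))"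
      by (simp only: sum.distrib flip: sum_distrib_left)
    also have "\<dots> \<le> 2 powr p * ((\<Sum>j\<in>UNIV. (norm (x + b $ j) / ?m ^ Suc n) powr p)
        + (norm x / ?m ^ n) powr p)"
    proof (intro mult_left_mono add_left_mono)
      have "(\<Sum>j\<in>(UNIV :: 'm set). (norm x / ?m ^ Suc n) powr p)
          \<le> (\<Sum>j\<in>(UNIV :: 'm set). norm x / ?m ^ Suc n) powr p"
        using p by (intro sum_powr_le_powr_sum) auto
      thus "(\<Sum>j\<in>(UNIV :: 'm set). (norm x / ?m ^ Suc n) powr p) \<le> (norm x / ?m ^ n) powr p"
        by simp
    qed simp
    finally show ?thesis unfolding b(2,3) x_def .
  qed
  have "energy p (Suc n) (mdiff X (Suc n)) \<le> (\<Sum>\<omega>\<in>atoms (\<F> n).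
      2 powr p * ((\<Sum>j\<in>UNIV. (norm (val (X (Suc n)) (J n \<omega> j)) / ?m ^ Suc n) powr p)
        + (norm (val (X n) \<omega>) / ?m ^ n) powr p))"
    unfolding energy_def sum_atoms_Suc by (intro sum_mono step)
  also have "\<dots> = 2 powr p * (energy p (Suc n) (X (Suc n)) + energy p n (X n))"
    unfolding energy_def sum_atoms_Suc by (simp only: sum.distrib flip: sum_distrib_left)
  finally show ?thesis .
qed

lemma mass_le_L1_norm:
  assumes X: "X \<in> W_space M \<F> J W"
  shows "ennreal (mass n (X n)) \<le> L1_norm M X"
  unfolding L1_norm_def nn_integral_norm_eq_mass[OF W_space_measurable[OF X], symmetric]
  by (rule SUP_upper) simp

lemma besov_estimate:
  "\<exists>C\<ge>0. \<forall>X \<in> W_space M \<F> J W.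
    besov_norm M CARD('m) (- ((p - 1) / p)) p X \<le> ennreal C * L1_norm M X"
proof -
  obtain \<theta> C where \<theta>: "0 \<le> \<theta>" "\<theta> < 1" "0 \<le> C" and
    atom: "\<And>x b. b \<in> W \<Longrightarrow>
      (\<Sum>j\<in>UNIV. (norm (x + b $ j) / real CARD('m)) powr p)
      \<le> \<theta> * norm x powr p + C * ((\<Sum>j\<in>UNIV. norm (x + b $ j)) / real CARD('m) - norm x) powr p"
    using atom_inequality[OF two_le_m W p] by blast
  define \<theta>' C' where "\<theta>' = \<theta> powr (1 / p)" and "C' = C powr (1 / p)"
  have \<theta>': "0 \<le> \<theta>'" "\<theta>' < 1" "0 \<le> C'"
    using \<theta> p powr_less_mono2[of "1 / p" \<theta> 1] by (auto simp: \<theta>'_def C'_def)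
  define K where "K = (1 + C') / (1 - \<theta>')"
  have K: "0 \<le> K" using \<theta>' by (simp add: K_def)
  have main: "besov_norm M CARD('m) (- ((p - 1) / p)) p X \<le> ennreal (1 + 4 * K) * L1_norm M X"
    if X: "X \<in> W_space M \<F> J W" for X
  proof -
    define L where "L = enn2real (L1_norm M X)"
    have "L1_norm M X < \<infinity>" using X by (simp add: W_space_def L1_space_def)
    hence L: "L1_norm M X = ennreal L" "0 \<le> L" by (auto simp: L_def)
    define S where "S n = mass n (X n)" for n
    define u where "u n = energy p n (X n) powr (1 / p)" for n
    have S: "0 \<le> S n" "S n \<le> L" for n
      using mass_le_L1_norm[OF X, of n] L by (auto simp: S_def mass_nonneg)
    have u: "0 \<le> u n" for n by (simp add: u_def)
    have u0: "u 0 \<le> S 0"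
    proof -
      have "u 0 \<le> (mass 0 (X 0) powr p) powr (1 / p)" unfolding u_def
        using p by (intro powr_mono2 energy_le_mass_powr energy_nonneg) auto
      thus ?thesis using p by (simp add: powr_powr S_def mass_nonneg)
    qed
    \<comment> \<open>Taking \<open>p\<close>-th roots: \<open>y \<mapsto> y powr (1 / p)\<close> is subadditive, so the root splits the sum.\<close>
    have u_step: "u (Suc n) \<le> \<theta>' * u n + C' * (S (Suc n) - S n)" for n
    proof -
      have inc: "0 \<le> S (Suc n) - S n" using mass_mono[OF X] by (simp add: S_def)
      have "u (Suc n) \<le> (\<theta> * energy p n (X n) + C * (S (Suc n) - S n) powr p) powr (1 / p)"
        unfolding u_def S_def using p
        by (intro powr_mono2 energy_step[OF \<theta>(1,3) X atom] energy_nonneg) auto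
      also have "\<dots> \<le> (\<theta> * energy p n (X n)) powr (1 / p) + (C * (S (Suc n) - S n) powr p) powr (1 / p)"
        using \<theta> p by (intro powr_inverse_subadditive) (auto intro!: mult_nonneg_nonneg energy_nonneg)
      also have "\<dots> = \<theta>' * u n + C' * (S (Suc n) - S n)"
        using \<theta> p inc by (simp add: powr_mult powr_powr energy_nonneg \<theta>'_def C'_def u_def)
      finally show ?thesis .
    qed
    have sum_u: "(\<Sum>n<N. u n) \<le> K * L" for N
      unfolding K_def
      by (rule sum_bound_of_contraction_with_increments[OF u_step u0 u S \<theta>'])
    define t where "t n = real CARD('m) powr (- ((p - 1) / p) * real n) * Lp_norm M p (mdiff X n)" for n
    have t_eq: "t n = energy p n (mdiff X n) powr (1 / p)" for n
      unfolding t_def by (rule scaled_Lp_norm_eq_energy[OF mdiff_measurable[OF X] p])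
    have t0: "0 \<le> t n" for n by (simp add: t_eq)
    \<comment> \<open>The \<open>p\<close>-th root of the factor \<open>2 powr p\<close> in the energy of a jump is \<open>2\<close>.\<close>
    have t_Suc: "t (Suc n) \<le> 2 * (u (Suc n) + u n)" for n
    proof -
      have "t (Suc n) \<le> (2 powr p * (energy p (Suc n) (X (Suc n)) + energy p n (X n))) powr (1 / p)"
        unfolding t_eq using p by (intro powr_mono2 energy_mdiff_le[OF X] energy_nonneg) auto
      also have "\<dots> = 2 * (energy p (Suc n) (X (Suc n)) + energy p n (X n)) powr (1 / p)"
        using p by (simp add: powr_mult powr_powr energy_nonneg)
      also have "\<dots> \<le> 2 * (u (Suc n) + u n)"
        unfolding u_def using p energy_nonneg by (intro mult_left_mono powr_inverse_subadditive) auto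
      finally show ?thesis .
    qed
    \<comment> \<open>One \<open>L\<close> bounds the term of index \<open>0\<close>; each sum of values \<open>u\<close> is at most \<open>K * L\<close> and enters twice.\<close>
    have t_sum: "(\<Sum>n<N. t n) \<le> (1 + 4 * K) * L" for N
    proof -
      have "(\<Sum>n<N. t n) \<le> (\<Sum>n<Suc N. t n)" using t0 by simp
      also have "\<dots> = u 0 + (\<Sum>n<N. t (Suc n))"
        by (simp only: sum.lessThan_Suc_shift) (simp add: t_eq u_def)
      also have "\<dots> \<le> u 0 + (\<Sum>n<N. 2 * (u (Suc n) + u n))"
        by (intro add_left_mono sum_mono t_Suc)
      also have "\<dots> = u 0 + 2 * ((\<Sum>n<N. u (Suc n)) + (\<Sum>n<N. u n))"
        by (simp only: sum.distrib flip: sum_distrib_left)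
      also have "(\<Sum>n<N. u (Suc n)) = (\<Sum>n<Suc N. u n) - u 0"
        by (simp add: sum.lessThan_Suc_shift del: sum.lessThan_Suc)
      also have "u 0 + 2 * ((\<Sum>n<Suc N. u n) - u 0 + (\<Sum>n<N. u n)) \<le> (1 + 4 * K) * L"
        using sum_u[of "Suc N"] sum_u[of N] u0 u[of 0] S(2)[of 0] by (simp add: algebra_simps)
      finally show ?thesis .
    qed
    have "(\<Sum>n. ennreal (t n)) \<le> ennreal ((1 + 4 * K) * L)"
    proof (rule suminf_le_const)
      show "(\<Sum>n<N. ennreal (t n)) \<le> ennreal ((1 + 4 * K) * L)" for N
        using t_sum[of N] by (simp add: sum_ennreal t0 ennreal_leI)
    qed simp
    thus ?thesis using K L by (simp add: besov_norm_def t_def ennreal_mult)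
  qed
  thus ?thesis using K by (intro exI[of _ "1 + 4 * K"]) auto
qed

end

section \<open>Riesz potentials\<close>

lemma mdiff_riesz:
  "mdiff (riesz m \<alpha> X) 0 = (\<lambda>x. 0)"
  "mdiff (riesz m \<alpha> X) (Suc n) = (\<lambda>x. (real m powr (- \<alpha> * real (Suc n))) *\<^sub>R mdiff X (Suc n) x)"
  by (auto simp: riesz_def fun_eq_iff simp del: mdiff.simps(2) simp add: mdiff.simps(2)[of "riesz m \<alpha> X"])

lemma integrable_mdiff:
  fixes X :: "nat \<Rightarrow> 'a \<Rightarrow> 'v::euclidean_space"
  assumes "martingale M \<F> X"
  shows "integrable M (mdiff X n)"
  using assms by (cases n) (auto simp: martingale_def)

lemma (in uniform_filtration) martingale_riesz:
  fixes X :: "nat \<Rightarrow> 'a \<Rightarrow> 'v::euclidean_space"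
  assumes X: "martingale M \<F> X"
  shows "martingale M \<F> (riesz k \<alpha> X)"
proof -
  let ?R = "riesz k \<alpha> X"
  have meas: "mdiff X i \<in> borel_measurable (\<F> n)" if "i \<le> n" for i n
  proof (cases i)
    case 0
    thus ?thesis using X measurable_F_mono[of "X 0" 0 n] by (simp add: martingale_def)
  next
    case (Suc j)
    have "X j \<in> borel_measurable (\<F> n)" "X (Suc j) \<in> borel_measurable (\<F> n)"
      using X that Suc by (auto simp: martingale_def intro: measurable_F_mono[of _ j] measurable_F_mono[of _ "Suc j"])
    thus ?thesis by (simp add: Suc)
  qed
  have int: "integrable M (?R n)" for n
    unfolding riesz_def[abs_def] by (intro Bochner_Integration.integrable_sum integrable_scaleR_right integrable_mdiff[OF X])
  have "(LINT x:A|M. ?R (Suc n) x) = (LINT x:A|M. ?R n x)" if A: "A \<in> sets (\<F> n)" for n A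
  proof -
    let ?c = "real k powr (- \<alpha> * real (Suc n))"
    have AM: "A \<in> sets M" using A by (rule sets_F_M)
    have sint: "set_integrable M A f" if "integrable M f" for f :: "'a \<Rightarrow> 'v"
      using that AM unfolding set_integrable_def by (rule integrable_mult_indicator[rotated])
    have iX: "integrable M (X i)" for i using X by (simp add: martingale_def)
    have "(LINT x:A|M. mdiff X (Suc n) x) = (LINT x:A|M. X (Suc n) x) - (LINT x:A|M. X n x)"
      unfolding mdiff.simps by (intro set_integral_diff sint iX)
    also have "\<dots> = 0" using X A by (simp add: martingale_def)
    finally have zero: "(LINT x:A|M. mdiff X (Suc n) x) = 0" .
    have "?R (Suc n) = (\<lambda>x. ?R n x + ?c *\<^sub>R mdiff X (Suc n) x)"
      by (simp add: riesz_def fun_eq_iff)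
    hence "(LINT x:A|M. ?R (Suc n) x) = (LINT x:A|M. ?R n x) + (LINT x:A|M. ?c *\<^sub>R mdiff X (Suc n) x)"
      by (simp only:) (intro set_integral_add sint int integrable_scaleR_right integrable_mdiff[OF X])
    also have "(LINT x:A|M. ?c *\<^sub>R mdiff X (Suc n) x) = ?c *\<^sub>R (LINT x:A|M. mdiff X (Suc n) x)"
      unfolding set_lebesgue_integral_def by (simp only: scaleR_left_commute[of _ ?c] integral_scaleR_right)
    finally show ?thesis by (simp only: zero scaleR_zero_right add_0_right)
  qed
  moreover have "?R n \<in> borel_measurable (\<F> n)" for n
    unfolding riesz_def[abs_def]
    by (intro borel_measurable_sum borel_measurable_scaleR borel_measurable_const meas) auto
  ultimately show ?thesis using int by (simp add: martingale_def)
qed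

lemma Lp_norm_scaleR:
  fixes f :: "'a \<Rightarrow> 'v::euclidean_space"
  assumes "0 \<le> c" "0 < p"
  shows "Lp_norm M p (\<lambda>x. c *\<^sub>R f x) = c * Lp_norm M p f"
  using assms by (simp add: Lp_norm_def powr_mult powr_powr)

text \<open>The potential multiplies the \<open>n\<close>-th difference by \<open>m\<^sup>-\<^sup>\<alpha>\<^sup>n\<close>, which is exactly the Besov weight of
  smoothness \<open>-\<alpha>\<close>; it only loses the difference of index \<open>0\<close>.\<close>

lemma besov_norm_riesz_le:
  fixes X :: "nat \<Rightarrow> 'a \<Rightarrow> 'v::euclidean_space"
  assumes "0 < p" "0 < m"
  shows "besov_norm M m 0 p (riesz m \<alpha> X) \<le> besov_norm M m (- \<alpha>) p X"
  unfolding besov_norm_def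
proof (intro suminf_le allI ennreal_leI)
  fix n
  show "real m powr (0 * real n) * Lp_norm M p (mdiff (riesz m \<alpha> X) n)
      \<le> real m powr (- \<alpha> * real n) * Lp_norm M p (mdiff X n)"
  proof (cases n)
    case 0
    thus ?thesis using assms by (simp only: mdiff_riesz) (simp add: Lp_norm_def)
  next
    case (Suc k)
    thus ?thesis using assms by (simp only: Suc mdiff_riesz Lp_norm_scaleR powr_ge_zero) simp
  qed
qed auto

theorem theorem1p10:
  fixes M :: "'a measure" and \<F> :: "nat \<Rightarrow> 'a measure"
    and J :: "nat \<Rightarrow> 'a set \<Rightarrow> 'm::finite \<Rightarrow> 'a set"
    and W :: "((real ^ 'l::finite) ^ 'm) set" and p :: real
  assumes "CARD('m) \<ge> 3"
    and "uniform_filtration M \<F> CARD('m)"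
    and "\<And>n \<omega>. \<omega> \<in> atoms (\<F> n) \<Longrightarrow> bij_betw (J n \<omega>) UNIV (children \<F> n \<omega>)"
    and "subspace W" and "W \<subseteq> V_pow"
    and "second_structural_condition W"
    and "1 < p"
  shows "(\<exists>C\<ge>0. \<forall>X \<in> W_space M \<F> J W.
            riesz CARD('m) ((p - 1) / p) X \<in> besov_space M \<F> CARD('m) 0 p \<and>
            besov_norm M CARD('m) 0 p (riesz CARD('m) ((p - 1) / p) X) \<le> ennreal C * L1_norm M X) \<and>
         (\<exists>C\<ge>0. \<forall>X \<in> W_space M \<F> J W.
            X \<in> besov_space M \<F> CARD('m) (- ((p - 1) / p)) p \<and>
            besov_norm M CARD('m) (- ((p - 1) / p)) p X \<le> ennreal C * L1_norm M X)"
proof -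
  interpret structured_filtration M \<F> J W p
    using assms by (intro structured_filtration.intro structured_filtration_axioms.intro) auto
  obtain C where C: "0 \<le> C" "\<And>X. X \<in> W_space M \<F> J W \<Longrightarrow>
      besov_norm M CARD('m) (- ((p - 1) / p)) p X \<le> ennreal C * L1_norm M X"
    using besov_estimate by blast
  have mart: "martingale M \<F> X" if "X \<in> W_space M \<F> J W" for X
    using that by (simp add: W_space_def L1_space_def)
  have finite: "ennreal C * L1_norm M X < \<infinity>" if "X \<in> W_space M \<F> J W" for X
    using that by (simp add: W_space_def L1_space_def ennreal_mult_less_top)
  have riesz: "besov_norm M CARD('m) 0 p (riesz CARD('m) ((p - 1) / p) X) \<le> ennreal C * L1_norm M X"
    if "X \<in> W_space M \<F> J W" for X
    using besov_norm_riesz_le[of p "CARD('m)" M "(p - 1) / p" X] C(2)[OF that] p m_pos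
    by (auto intro: order_trans)
  show ?thesis
  proof (intro conjI exI[of _ C] ballI C(1))
    fix X assume X: "X \<in> W_space M \<F> J W"
    show "riesz CARD('m) ((p - 1) / p) X \<in> besov_space M \<F> CARD('m) 0 p"
      using martingale_riesz[OF mart[OF X]] le_less_trans[OF riesz[OF X] finite[OF X]]
      by (simp add: besov_space_def)
    show "X \<in> besov_space M \<F> CARD('m) (- ((p - 1) / p)) p"
      using mart[OF X] le_less_trans[OF C(2)[OF X] finite[OF X]] by (simp add: besov_space_def)
  qed (fact riesz C(2))+
qed

end
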